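(* Let $\mathcal{M}$ be a linearly ordered complete q-effect algebra with underlying set $M$, let $(S,T,R)$ be a frame and let $G^*:M^T\to M^S$ be defined by $$G^*(p)(s)=\bigwedge\{p(t)\mid t\in T,\ sRt\}$$ for all $p\in M^T$ and $s\in S$. Then $G^*$ has a left adjoint $P^*:M^S\to M^T$ such that $(P^*,G^* )$ is a Galois q-connection (between the direct powers $\mathcal{M}^S$ and $\mathcal{M}^T$). In this case, for all $r\in M^S$ and $t\in T$, $$P^*(r)(t)=\bigvee\{r(s)\mid s\in S,\ sRt\}.$$
   Context: An effect algebra is a structure $(E;+,0,1)$ with distinguished elements $0\neq 1$ of $E$ and a partial binary operation $+$ such that for $x,y,z\in E$: (E1) if $x+y$ is defined then $y+x$ is defined and $x+y=y+x$; (E2) if $y+z$ and $x+(y+z)$ are defined then $x+y$ and $(x+y)+z$ are defined and $(x+y)+z=x+(y+z)$; (E3) for each $x$ there is a unique $x'\in E$ with $x+x'=1$; (E4) if $x+1$ is defined then $x=0$. The induced order is $x\leq y$ iff $x+z=y$ for some $z\in E$; it is a partial order with bottom $0$ and top $1$, and $x+y$ is defined iff $x\leq y'$. The dual partial operation: $x\cdot y$ is defined iff $x'\leq y$, and then $x\cdot y=(x'+y')'$. A q-effect algebra $(E;+,q,d,0,1)$ is an effect algebra with maps $q,d:E\to E$ such that for all $x,y,z\in E$: (Q1) $d(x')=q(x)'$; (Q2) $d(0)=0=q(0)$; (Q3) $d$ is order-preserving; (Q4) $x'\leq x$ implies $x\cdot x=d(x)$; (Q5) $z\leq x$, $z\leq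 y$ and $y'\leq x$ imply $d(z)\leq x\cdot y$. It is linearly ordered (complete) if its induced order is linear (a complete lattice). The direct power $\mathcal{M}^T$ of a q-effect algebra is a q-effect algebra with all operations and the order componentwise. Empty meets equal $1$ and empty joins equal $0$. For q-effect algebras $\mathcal{E}_1,\mathcal{E}_2$ a pair $(f,g)$, $f:E_1\to E_2$, $g:E_2\to E_1$, is a Galois connection ($f$ is left adjoint of $g$) if $f(a)\leq b\iff a\leq g(b)$ for all $a\in E_1,b\in E_2$. It is a Galois q-connection if moreover $f(q_1(x))=q_2(f(x))$, $f(d_1(x))=d_2(f(x))$, $g(q_2(y))=q_1(g(y))$, $g(d_2(y))=d_1(g(y))$ for all $x\in E_1$, $y\in E_2$. A frame is a triple $(S,T,R)$ where $S,T$ are non-empty sets and $R\subseteq S\times T$. *)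

theory Defs
  imports "HOL-Algebra.Galois_Connection" "HOL-Library.FuncSet"
begin

text \<open>The partial operation is an option-valued function; \<open>None\<close> means undefined.\<close>

record 'a effect_alg = "'a partial_object" +
  padd :: "'a \<Rightarrow> 'a \<Rightarrow> 'a option"
  ezero :: 'a
  eone :: 'a

locale effect_algebra =
  fixes E :: "('a, 'b) effect_alg_scheme"
  assumes ezero_closed: "ezero E \<in> carrier E"
    and eone_closed: "eone E \<in> carrier E"
    and zero_neq_one: "ezero E \<noteq> eone E"
    and padd_closed:
      "\<lbrakk>x \<in> carrier E; y \<in> carrier E; padd E x y = Some z\<rbrakk> \<Longrightarrow> z \<in> carrier E"
    and E1:
      "\<lbrakk>x \<in> carrier E; y \<in> carrier E; padd E x y = Some z\<rbrakk> \<Longrightarrow> padd E y x = Some z"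
    and E2:
      "\<lbrakk>x \<in> carrier E; y \<in> carrier E; z \<in> carrier E; padd E y z = Some u; padd E x u = Some v\<rbrakk>
        \<Longrightarrow> \<exists>w. padd E x y = Some w \<and> padd E w z = Some v"
    and E3: "x \<in> carrier E \<Longrightarrow> \<exists>!y. y \<in> carrier E \<and> padd E x y = Some (eone E)"
    and E4: "\<lbrakk>x \<in> carrier E; padd E x (eone E) \<noteq> None\<rbrakk> \<Longrightarrow> x = ezero E"

definition ecompl :: "('a, 'b) effect_alg_scheme \<Rightarrow> 'a \<Rightarrow> 'a" where
  "ecompl E x = (THE y. y \<in> carrier E \<and> padd E x y = Some (eone E))"

definition eorder :: "('a, 'b) effect_alg_scheme \<Rightarrow> 'a gorder" where
  "eorder E =
    \<lparr>carrier = carrier E, eq = (=), le = (\<lambda>x y. \<exists>z\<in>carrier E. padd E x z = Some y)\<rparr>"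

definition pmult :: "('a, 'b) effect_alg_scheme \<Rightarrow> 'a \<Rightarrow> 'a \<Rightarrow> 'a option" where
  "pmult E x y =
    (if ecompl E x \<sqsubseteq>\<^bsub>eorder E\<^esub> y
     then map_option (ecompl E) (padd E (ecompl E x) (ecompl E y))
     else None)"

record 'a q_effect_alg = "'a effect_alg" +
  qmap :: "'a \<Rightarrow> 'a"
  dmap :: "'a \<Rightarrow> 'a"

text \<open>In \<open>Q5\<close> the premise \<open>y' \<le> x\<close> is what makes the product of \<open>x\<close> and \<open>y\<close> defined, so the
  inequality is stated together with its definedness.\<close>

locale q_effect_algebra = effect_algebra E
  for E :: "('a, 'b) q_effect_alg_scheme" +
  assumes qmap_closed: "qmap E \<in> carrier E \<rightarrow> carrier E"
    and dmap_closed: "dmap E \<in> carrier E \<rightarrow> carrier E"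
    and Q1: "x \<in> carrier E \<Longrightarrow> dmap E (ecompl E x) = ecompl E (qmap E x)"
    and Q2: "dmap E (ezero E) = ezero E" "qmap E (ezero E) = ezero E"
    and Q3: "\<lbrakk>x \<in> carrier E; y \<in> carrier E; x \<sqsubseteq>\<^bsub>eorder E\<^esub> y\<rbrakk>
      \<Longrightarrow> dmap E x \<sqsubseteq>\<^bsub>eorder E\<^esub> dmap E y"
    and Q4: "\<lbrakk>x \<in> carrier E; ecompl E x \<sqsubseteq>\<^bsub>eorder E\<^esub> x\<rbrakk> \<Longrightarrow> pmult E x x = Some (dmap E x)"
    and Q5: "\<lbrakk>x \<in> carrier E; y \<in> carrier E; z \<in> carrier E;
        z \<sqsubseteq>\<^bsub>eorder E\<^esub> x; z \<sqsubseteq>\<^bsub>eorder E\<^esub> y; ecompl E y \<sqsubseteq>\<^bsub>eorder E\<^esub> x\<rbrakk>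
      \<Longrightarrow> \<exists>w. pmult E x y = Some w \<and> dmap E z \<sqsubseteq>\<^bsub>eorder E\<^esub> w"

text \<open>Elements of the power are the extensional functions on \<open>T\<close>, so that equality in the
  carrier is equality on \<open>T\<close>.\<close>

definition direct_power :: "('a, 'b) q_effect_alg_scheme \<Rightarrow> 't set \<Rightarrow> ('t \<Rightarrow> 'a) q_effect_alg" where
  "direct_power M T =
    \<lparr>carrier = T \<rightarrow>\<^sub>E carrier M,
     padd = (\<lambda>f g. if \<forall>t\<in>T. padd M (f t) (g t) \<noteq> None
                   then Some (\<lambda>t\<in>T. the (padd M (f t) (g t))) else None),
     ezero = (\<lambda>t\<in>T. ezero M),
     eone = (\<lambda>t\<in>T. eone M),
     qmap = (\<lambda>f. \<lambda>t\<in>T. qmap M (f t)),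
     dmap = (\<lambda>f. \<lambda>t\<in>T. dmap M (f t))\<rparr>"

locale galois_q_connection =
  E1: q_effect_algebra E1 + E2: q_effect_algebra E2 +
  galois_connection "\<lparr>orderA = eorder E1, orderB = eorder E2, lower = f, upper = g\<rparr>"
  for E1 :: "('a, 'c) q_effect_alg_scheme" and E2 :: "('b, 'd) q_effect_alg_scheme"
    and f :: "'a \<Rightarrow> 'b" and g :: "'b \<Rightarrow> 'a" +
  assumes f_qmap: "x \<in> carrier E1 \<Longrightarrow> f (qmap E1 x) = qmap E2 (f x)"
    and f_dmap: "x \<in> carrier E1 \<Longrightarrow> f (dmap E1 x) = dmap E2 (f x)"
    and g_qmap: "y \<in> carrier E2 \<Longrightarrow> g (qmap E2 y) = qmap E1 (g y)"
    and g_dmap: "y \<in> carrier E2 \<Longrightarrow> g (dmap E2 y) = dmap E1 (g y)"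

definition frame :: "'s set \<Rightarrow> 't set \<Rightarrow> ('s \<times> 't) set \<Rightarrow> bool" where
  "frame S T R \<longleftrightarrow> S \<noteq> {} \<and> T \<noteq> {} \<and> R \<subseteq> S \<times> T"

definition G_star ::
  "('a, 'b) q_effect_alg_scheme \<Rightarrow> 's set \<Rightarrow> 't set \<Rightarrow> ('s \<times> 't) set \<Rightarrow> ('t \<Rightarrow> 'a) \<Rightarrow> 's \<Rightarrow> 'a" where
  "G_star M S T R p = (\<lambda>s\<in>S. \<Sqinter>\<^bsub>eorder M\<^esub> {p t |t. t \<in> T \<and> (s, t) \<in> R})"

end

theory Submission
  imports Defs
begin

text \<open>
  The partial operation of \<open>M\<close> and the maps \<open>q\<close>, \<open>d\<close> act pointwise on the powers, while
  \<open>P\<^sup>*\<close> and \<open>G\<^sup>*\<close> compute one join and one meet in \<open>M\<close> per coordinate. The adjunction therefore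
  holds for purely order-theoretic reasons (\<open>P_star_adjoint\<close>), and compatibility with \<open>q\<close> and \<open>d\<close>
  comes down to one fact about the chain: in a complete linearly ordered q-effect algebra, \<open>q\<close> and
  \<open>d\<close> preserve arbitrary meets and joins.

  On a chain \<open>q\<close> is determined by the effect algebra. Write \<open>x \<oplus> y\<close> for \<open>x + y\<close> truncated at \<open>1\<close>,
  that is, extended by the value \<open>1\<close> where the sum is undefined. Then \<open>q(x) = x \<oplus> x\<close>
  (\<open>qmap_eq_tsum\<close>): the axiom \<open>Q4\<close> settles the elements below their complement, and \<open>Q5\<close> forces
  \<open>q(x) = 1\<close> for the others. Translation by a fixed element is an order isomorphism onto its image,
  so by residuation \<open>\<oplus>\<close> preserves all meets and all non-empty joins in each argument
  (\<open>le_tsum_Inf\<close>, \<open>tsum_Sup_le\<close>). Linearity reduces a bound on the mixed sums \<open>a \<oplus> b\<close> with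
  \<open>a\<close>, \<open>b\<close> in a set to one on the sums \<open>a \<oplus> a\<close>, so \<open>q\<close> preserves meets and joins as
  well (\<open>qmap_Inf\<close>, \<open>qmap_Sup\<close>); \<open>Q1\<close> transfers this to \<open>d\<close>, because complementation exchanges
  meets and joins.

  The formula for an arbitrary left adjoint follows from the uniqueness of adjoints
  (\<open>lower_adjoint_unique\<close>).
\<close>

section \<open>Effect algebras\<close>

context effect_algebra
begin

abbreviation le_E (infix \<open>\<preceq>\<close> 50)
  where "x \<preceq> y \<equiv> x \<sqsubseteq>\<^bsub>eorder E\<^esub> y"

abbreviation compl_E (\<open>\<^bold>-_\<close> [80] 80)
  where "\<^bold>-x \<equiv> ecompl E x"

lemma carrier_eorder [simp]: "carrier (eorder E) = carrier E"
  by (simp add: eorder_def)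

lemma eq_eorder [simp]: "x .=\<^bsub>eorder E\<^esub> y \<longleftrightarrow> x = y"
  by (simp add: eorder_def)

lemma leI: "\<lbrakk>z \<in> carrier E; padd E x z = Some y\<rbrakk> \<Longrightarrow> x \<preceq> y"
  by (auto simp: eorder_def)

lemma leE:
  assumes "x \<preceq> y"
  obtains z where "z \<in> carrier E" "padd E x z = Some y"
  using assms by (auto simp: eorder_def)

lemma ecompl_props: "x \<in> carrier E \<Longrightarrow> \<^bold>-x \<in> carrier E \<and> padd E x (\<^bold>-x) = Some (eone E)"
  unfolding ecompl_def by (rule theI') (rule E3)

lemma ecompl_closed [simp]: "x \<in> carrier E \<Longrightarrow> \<^bold>-x \<in> carrier E"
  and padd_ecompl: "x \<in> carrier E \<Longrightarrow> padd E x (\<^bold>-x) = Some (eone E)"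
  using ecompl_props by auto

lemma ecompl_unique:
  "\<lbrakk>x \<in> carrier E; y \<in> carrier E; padd E x y = Some (eone E)\<rbrakk> \<Longrightarrow> y = \<^bold>-x"
  using E3 ecompl_props by blast

lemma ecompl_ecompl [simp]: "x \<in> carrier E \<Longrightarrow> \<^bold>-\<^bold>-x = x"
  using E1 ecompl_closed ecompl_unique padd_ecompl by metis

lemma padd_commute: "\<lbrakk>x \<in> carrier E; y \<in> carrier E\<rbrakk> \<Longrightarrow> padd E x y = padd E y x"
  using E1 by (metis not_Some_eq)

lemma padd_assoc_left:
  assumes "x \<in> carrier E" "y \<in> carrier E" "z \<in> carrier E"
    and "padd E y z = Some u" "padd E x u = Some v"
  obtains w where "w \<in> carrier E" "padd E x y = Some w" "padd E w z = Some v"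
  using E2[OF assms] padd_closed assms by blast

text \<open>The axiom \<open>E2\<close> moves the brackets in one direction only; commutativity gives the other.\<close>

lemma padd_assoc_right:
  assumes "x \<in> carrier E" "y \<in> carrier E" "z \<in> carrier E"
    and "padd E x y = Some w" "padd E w z = Some v"
  obtains u where "u \<in> carrier E" "padd E y z = Some u" "padd E x u = Some v"
proof -
  have "w \<in> carrier E" using assms padd_closed by blast
  then obtain u where "u \<in> carrier E" "padd E z y = Some u" "padd E u x = Some v"
    using assms padd_assoc_left[of z y x w v] E1 by metis
  then show thesis using that assms E1 by metis
qed

lemma padd_cancel:
  assumes "x \<in> carrier E" "y \<in> carrier E" "z \<in> carrier E"
    and "padd E x y = Some u" "padd E x z = Some u"
  shows "y = z"
proof -
  have u: "u \<in> carrier E" using assms padd_closed by blast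
  (* Both y and z are the complement of v, the sum of the complement of u and x. *)
  have u1: "padd E (\<^bold>-u) u = Some (eone E)"
    using padd_ecompl[OF u] padd_commute[OF u ecompl_closed[OF u]] by simp
  obtain v where v: "v \<in> carrier E" "padd E (\<^bold>-u) x = Some v" "padd E v y = Some (eone E)"
    using padd_assoc_left[OF _ assms(1,2) assms(4) u1] u by auto
  obtain v' where v': "padd E (\<^bold>-u) x = Some v'" "padd E v' z = Some (eone E)"
    using padd_assoc_left[OF _ assms(1,3) assms(5) u1] u by auto
  from v v' show ?thesis using assms ecompl_unique by (metis option.inject)
qed

lemma ecompl_one: "\<^bold>-eone E = ezero E"
proof (rule E4)
  show "padd E (\<^bold>-eone E) (eone E) \<noteq> None"
    using padd_ecompl[OF eone_closed]
      padd_commute[OF ecompl_closed[OF eone_closed] eone_closed] by simp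
qed (simp add: eone_closed)

lemma ecompl_zero: "\<^bold>-ezero E = eone E"
  using ecompl_one ecompl_ecompl[OF eone_closed] by simp

text \<open>Both \<open>x\<close> and \<open>x + 0\<close> are complements of \<open>\<^bold>-x\<close>, since \<open>1 + 0 = 1\<close>.\<close>

lemma padd_zero:
  assumes x: "x \<in> carrier E"
  shows "padd E x (ezero E) = Some x"
proof -
  have "padd E (\<^bold>-x) x = Some (eone E)"
    using padd_ecompl[OF x] padd_commute[OF x ecompl_closed[OF x]] by simp
  moreover have "padd E (eone E) (ezero E) = Some (eone E)"
    using padd_ecompl[OF eone_closed] ecompl_one by simp
  ultimately obtain u where u: "u \<in> carrier E" "padd E x (ezero E) = Some u"
      "padd E (\<^bold>-x) u = Some (eone E)"
    by (rule padd_assoc_right[OF ecompl_closed[OF x] x ezero_closed])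
  then have "u = \<^bold>-\<^bold>-x" using x ecompl_unique by simp
  with u x show ?thesis by simp
qed

text \<open>Adding \<open>1\<close> to \<open>x + y = 0\<close> shows that \<open>y + 1\<close> is defined, so \<open>E4\<close> applies to \<open>y\<close>.\<close>

lemma padd_eq_zero:
  assumes "x \<in> carrier E" "y \<in> carrier E" "padd E x y = Some (ezero E)"
  shows "y = ezero E"
proof -
  have "padd E (ezero E) (eone E) = Some (eone E)"
    using padd_zero[OF eone_closed] padd_commute[OF ezero_closed eone_closed] by simp
  then show ?thesis
    using assms padd_assoc_right[of x y "eone E"] eone_closed E4 by (metis option.discI)
qed

lemma le_reflexive: "x \<in> carrier E \<Longrightarrow> x \<preceq> x"
  using leI padd_zero ezero_closed by blast

lemma le_transitive: 
  assumes "x \<preceq> y" "y \<preceq> z" "x \<in> carrier E"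
  shows "x \<preceq> z"
  using assms by (meson leE leI padd_assoc_right)

lemma le_antisymmetric:
  assumes "x \<preceq> y" "y \<preceq> x" "x \<in> carrier E"
  shows "x = y"
proof -
  obtain u v where uv: "u \<in> carrier E" "padd E x u = Some y" "v \<in> carrier E" "padd E y v = Some x"
    using assms by (meson leE)
  then obtain w where w: "w \<in> carrier E" "padd E u v = Some w" "padd E x w = Some x"
    using assms padd_assoc_right by metis
  then have "w = ezero E" using padd_cancel padd_zero assms ezero_closed by metis
  with w uv have "u = ezero E"
    using padd_eq_zero padd_commute by metis
  with uv show ?thesis using padd_zero assms by simp
qed

sublocale eorder: partial_order "eorder E"
  by unfold_locales (auto simp: fun_eq_iff intro: le_reflexive le_transitive le_antisymmetric)

lemma padd_defined_iff:
  assumes "x \<in> carrier E" "y \<in> carrier E"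
  shows "padd E x y \<noteq> None \<longleftrightarrow> y \<preceq> \<^bold>-x"
proof
  assume "padd E x y \<noteq> None"
  then obtain u where u: "padd E x y = Some u" "u \<in> carrier E"
    using assms padd_closed by blast
  obtain w where w: "w \<in> carrier E" "padd E y (\<^bold>-u) = Some w" "padd E x w = Some (eone E)"
    using padd_assoc_right[OF assms ecompl_closed[OF u(2)] u(1) padd_ecompl[OF u(2)]] .
  have "w = \<^bold>-x" using ecompl_unique[OF assms(1) w(1,3)] .
  with w(2) show "y \<preceq> \<^bold>-x" using leI[OF ecompl_closed[OF u(2)]] by simp
next
  assume "y \<preceq> \<^bold>-x"
  then obtain z where z: "z \<in> carrier E" "padd E y z = Some (\<^bold>-x)" by (rule leE)
  obtain w where "padd E x y = Some w"
    using padd_assoc_left[OF assms z padd_ecompl[OF assms(1)]] .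
  then show "padd E x y \<noteq> None" by simp
qed

lemma ecompl_antimono:
  assumes "x \<preceq> y" "x \<in> carrier E" "y \<in> carrier E"
  shows "\<^bold>-y \<preceq> \<^bold>-x"
proof -
  have "padd E (\<^bold>-y) x \<noteq> None"
    using assms padd_defined_iff[of "\<^bold>-y" x] by simp
  then show ?thesis
    using assms padd_defined_iff[of x "\<^bold>-y"] padd_commute[of x "\<^bold>-y"] by simp
qed

lemma zero_le: "x \<in> carrier E \<Longrightarrow> ezero E \<preceq> x"
  using leI[of x "ezero E" x] padd_zero[of x] padd_commute[of x "ezero E"] ezero_closed by simp

lemma le_one: "x \<in> carrier E \<Longrightarrow> x \<preceq> eone E"
  using leI[OF ecompl_closed padd_ecompl] .

text \<open>Translation by \<open>c\<close> preserves the order by associativity and reflects it by cancellation. This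
  is what makes truncated addition residuated on a chain.\<close>

lemma padd_le_cancel:
  assumes "c \<in> carrier E" "x \<in> carrier E" "y \<in> carrier E"
    and "padd E c x = Some u" "padd E c y = Some v"
  shows "u \<preceq> v \<longleftrightarrow> x \<preceq> y"
proof
  assume "u \<preceq> v"
  then obtain z where z: "z \<in> carrier E" "padd E u z = Some v" by (rule leE)
  obtain w where "w \<in> carrier E" "padd E x z = Some w" "padd E c w = Some v"
    using padd_assoc_right[OF assms(1,2) z(1) assms(4) z(2)] .
  moreover from this have "w = y" using padd_cancel assms(1,3,5) by blast
  ultimately show "x \<preceq> y" using leI[OF z(1)] by simp
next
  assume "x \<preceq> y"
  then obtain z where z: "z \<in> carrier E" "padd E x z = Some y" by (rule leE)
  obtain w where "padd E c x = Some w" "padd E w z = Some v"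
    using padd_assoc_left[OF assms(1,2) z assms(5)] .
  then show "u \<preceq> v" using assms(4) leI[OF z(1)] by simp
qed

text \<open>The guard in the definition of the product says exactly that the sum of the complements is
  defined. In this form the product is visibly computed pointwise in a power.\<close>

lemma pmult_eq_Some_iff:
  assumes "x \<in> carrier E" "y \<in> carrier E"
  shows "pmult E x y = Some w \<longleftrightarrow> w \<in> carrier E \<and> padd E (\<^bold>-x) (\<^bold>-y) = Some (\<^bold>-w)"
proof -
  have "\<^bold>-x \<preceq> y \<longleftrightarrow> padd E (\<^bold>-x) (\<^bold>-y) \<noteq> None"
    using assms padd_defined_iff[of "\<^bold>-y" "\<^bold>-x"] padd_commute[of "\<^bold>-x" "\<^bold>-y"] by simp
  moreover have "u \<in> carrier E" if "padd E (\<^bold>-x) (\<^bold>-y) = Some u" for u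
    using that assms padd_closed ecompl_closed by blast
  ultimately have "pmult E x y = Some w \<longleftrightarrow> (\<exists>u\<in>carrier E. padd E (\<^bold>-x) (\<^bold>-y) = Some u \<and> \<^bold>-u = w)"
    by (cases "padd E (\<^bold>-x) (\<^bold>-y)") (simp_all add: pmult_def)
  also have "\<dots> \<longleftrightarrow> w \<in> carrier E \<and> padd E (\<^bold>-x) (\<^bold>-y) = Some (\<^bold>-w)"
    by (metis ecompl_closed ecompl_ecompl)
  finally show ?thesis .
qed

end

section \<open>Truncated addition\<close>

context effect_algebra
begin

definition tsum :: "'a \<Rightarrow> 'a \<Rightarrow> 'a" (infixl \<open>\<oplus>\<close> 65)
  where "x \<oplus> y = (case padd E x y of None \<Rightarrow> eone E | Some z \<Rightarrow> z)"

lemma tsum_closed [simp]: "\<lbrakk>x \<in> carrier E; y \<in> carrier E\<rbrakk> \<Longrightarrow> x \<oplus> y \<in> carrier E"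
  by (auto simp: tsum_def eone_closed intro: padd_closed split: option.split)

lemma tsum_commute: "\<lbrakk>x \<in> carrier E; y \<in> carrier E\<rbrakk> \<Longrightarrow> x \<oplus> y = y \<oplus> x"
  by (simp add: tsum_def padd_commute)

lemma le_tsum_left: "\<lbrakk>x \<in> carrier E; y \<in> carrier E\<rbrakk> \<Longrightarrow> x \<preceq> x \<oplus> y"
  by (auto simp: tsum_def intro: leI le_one split: option.split)


lemma tsum_mono_right:
  assumes "x \<preceq> y" "c \<in> carrier E" "x \<in> carrier E" "y \<in> carrier E"
  shows "c \<oplus> x \<preceq> c \<oplus> y"
proof (cases "padd E c y")
  case None
  then show ?thesis using assms le_one by (simp add: tsum_def[of c y])
next
  case (Some v)
  have "padd E c x \<noteq> None"
    using Some assms padd_defined_iff[of c] le_transitive ecompl_closed by (metis option.discI)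
  then obtain u where u: "padd E c x = Some u" by auto
  then show ?thesis using padd_le_cancel[OF assms(2-4) u Some] assms Some by (simp add: tsum_def)
qed

lemma tsum_mono:
  assumes "x \<preceq> x'" "y \<preceq> y'"
    and "x \<in> carrier E" "x' \<in> carrier E" "y \<in> carrier E" "y' \<in> carrier E"
  shows "x \<oplus> y \<preceq> x' \<oplus> y'"
proof (rule le_transitive)
  show "x \<oplus> y \<preceq> x \<oplus> y'" using assms tsum_mono_right by blast
  show "x \<oplus> y' \<preceq> x' \<oplus> y'"
    using assms tsum_mono_right[of x x' y'] tsum_commute by simp
qed (use assms in simp)

end

locale complete_q_chain = q_effect_algebra E
  for E :: "('a, 'b) q_effect_alg_scheme" +
  assumes linear: "\<lbrakk>x \<in> carrier E; y \<in> carrier E\<rbrakk> \<Longrightarrow> x \<preceq> y \<or> y \<preceq> x"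
    and complete: "complete_lattice (eorder E)"

sublocale complete_q_chain \<subseteq> lat: complete_lattice "eorder E"
  by (rule complete)

context complete_q_chain
begin

abbreviation Sup_E (\<open>\<^bold>\<Squnion>_\<close> [90] 90)
  where "\<^bold>\<Squnion>A \<equiv> \<Squnion>\<^bsub>eorder E\<^esub> A"

abbreviation Inf_E (\<open>\<^bold>\<Sqinter>_\<close> [90] 90)
  where "\<^bold>\<Sqinter>A \<equiv> \<Sqinter>\<^bsub>eorder E\<^esub> A"

lemma Sup_closed [simp]: "A \<subseteq> carrier E \<Longrightarrow> \<^bold>\<Squnion>A \<in> carrier E"
  and Sup_upper: "\<lbrakk>A \<subseteq> carrier E; x \<in> A\<rbrakk> \<Longrightarrow> x \<preceq> \<^bold>\<Squnion>A"
  and Sup_least: "\<lbrakk>A \<subseteq> carrier E; z \<in> carrier E; \<And>x. x \<in> A \<Longrightarrow> x \<preceq> z\<rbrakk> \<Longrightarrow> \<^bold>\<Squnion>A \<preceq> z"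
  and Inf_closed [simp]: "A \<subseteq> carrier E \<Longrightarrow> \<^bold>\<Sqinter>A \<in> carrier E"
  and Inf_lower: "\<lbrakk>A \<subseteq> carrier E; x \<in> A\<rbrakk> \<Longrightarrow> \<^bold>\<Sqinter>A \<preceq> x"
  and Inf_greatest: "\<lbrakk>A \<subseteq> carrier E; z \<in> carrier E; \<And>x. x \<in> A \<Longrightarrow> z \<preceq> x\<rbrakk> \<Longrightarrow> z \<preceq> \<^bold>\<Sqinter>A"
  using lat.weak.sup_closed lat.weak.sup_upper lat.weak.sup_least
    lat.weak.inf_closed lat.weak.inf_lower lat.weak.inf_greatest by simp_all

lemma Sup_eqI:
  assumes "A \<subseteq> carrier E" "s \<in> carrier E" "\<And>x. x \<in> A \<Longrightarrow> x \<preceq> s"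
    and "\<And>z. \<lbrakk>z \<in> carrier E; \<And>x. x \<in> A \<Longrightarrow> x \<preceq> z\<rbrakk> \<Longrightarrow> s \<preceq> z"
  shows "s = \<^bold>\<Squnion>A"
  by (rule le_antisymmetric) (use assms Sup_upper Sup_least in simp_all)

lemma Inf_eqI:
  assumes "A \<subseteq> carrier E" "s \<in> carrier E" "\<And>x. x \<in> A \<Longrightarrow> s \<preceq> x"
    and "\<And>z. \<lbrakk>z \<in> carrier E; \<And>x. x \<in> A \<Longrightarrow> z \<preceq> x\<rbrakk> \<Longrightarrow> z \<preceq> s"
  shows "s = \<^bold>\<Sqinter>A"
  by (rule le_antisymmetric) (use assms Inf_lower Inf_greatest in simp_all)

lemma ecompl_Sup: "A \<subseteq> carrier E \<Longrightarrow> \<^bold>-(\<^bold>\<Squnion>A) = \<^bold>\<Sqinter>(ecompl E ` A)"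
proof (rule Inf_eqI)
  assume A: "A \<subseteq> carrier E"
  show "\<^bold>-(\<^bold>\<Squnion>A) \<preceq> x" if "x \<in> ecompl E ` A" for x
    using that A by (auto intro!: ecompl_antimono Sup_upper)
  show "z \<preceq> \<^bold>-(\<^bold>\<Squnion>A)" if z: "z \<in> carrier E" "\<And>x. x \<in> ecompl E ` A \<Longrightarrow> z \<preceq> x" for z
  proof -
    have "x \<preceq> \<^bold>-z" if "x \<in> A" for x
      using ecompl_antimono[of z "\<^bold>-x"] z that A by auto
    then have "\<^bold>\<Squnion>A \<preceq> \<^bold>-z" using Sup_least A z by simp
    then show ?thesis using ecompl_antimono[of "\<^bold>\<Squnion>A" "\<^bold>-z"] A z by simp
  qed
qed (auto simp: image_subset_iff subset_iff)

lemma ecompl_Inf: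
  assumes "A \<subseteq> carrier E"
  shows "\<^bold>-(\<^bold>\<Sqinter>A) = \<^bold>\<Squnion>(ecompl E ` A)"
proof -
  have *: "ecompl E ` A \<subseteq> carrier E" "ecompl E ` ecompl E ` A = A"
    using assms by (force simp: image_image subset_iff)+
  have "\<^bold>-\<^bold>-\<^bold>\<Squnion>(ecompl E ` A) = \<^bold>-\<^bold>\<Sqinter>A"
    using ecompl_Sup[OF *(1)] *(2) by simp
  then show ?thesis using ecompl_ecompl[OF Sup_closed[OF *(1)]] by simp
qed

text \<open>The difference \<open>w\<close> of \<open>z\<close> and \<open>c\<close> is a residual of translation by \<open>c\<close>, also across the
  truncation: where \<open>c + x\<close> is undefined, linearity puts \<open>x\<close> above the complement of \<open>c\<close>, hence
  above \<open>w\<close>.\<close>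

lemma le_tsum_iff:
  assumes "c \<in> carrier E" "w \<in> carrier E" "padd E c w = Some z" "x \<in> carrier E"
  shows "z \<preceq> c \<oplus> x \<longleftrightarrow> w \<preceq> x"
proof (cases "padd E c x")
  case None
  then have "\<^bold>-c \<preceq> x"
    using assms padd_defined_iff[of c x] linear[of x "\<^bold>-c"] by auto
  moreover have "w \<preceq> \<^bold>-c" using assms padd_defined_iff[of c w] by simp
  ultimately have "w \<preceq> x" using le_transitive assms by blast
  moreover have "z \<preceq> eone E" using le_one padd_closed assms by blast
  ultimately show ?thesis using None by (simp add: tsum_def)
next
  case (Some u)
  then show ?thesis using padd_le_cancel[OF assms(1,2,4) assms(3) Some] by (simp add: tsum_def)
qed

text \<open>The case \<open>z = 1\<close> is excluded because there the left-hand side always holds, even for \<open>x\<close>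
  above the complement of \<open>c\<close>. For \<open>z \<noteq> 1\<close> both sides are false where \<open>c + x\<close> is undefined.\<close>

lemma tsum_le_iff:
  assumes "c \<in> carrier E" "w \<in> carrier E" "padd E c w = Some z" "x \<in> carrier E" "z \<noteq> eone E"
  shows "c \<oplus> x \<preceq> z \<longleftrightarrow> x \<preceq> w"
proof (cases "padd E c x")
  case None
  have z: "z \<in> carrier E" using padd_closed assms by blast
  have "\<not> x \<preceq> \<^bold>-c" using None assms padd_defined_iff[of c x] by simp
  moreover have "w \<preceq> \<^bold>-c" using assms padd_defined_iff[of c w] by simp
  ultimately have "\<not> x \<preceq> w" using le_transitive[of x w "\<^bold>-c"] assms by blast
  moreover have "\<not> eone E \<preceq> z" using le_antisymmetric[of z] le_one[OF z] assms z by auto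
  ultimately show ?thesis using None by (simp add: tsum_def)
next
  case (Some u)
  then show ?thesis using padd_le_cancel[OF assms(1,4,2) Some assms(3)] by (simp add: tsum_def)
qed

text \<open>If \<open>c\<close> is not below \<open>z\<close> there is no residual, but then linearity gives \<open>z \<preceq> c\<close>, and the
  claim is trivial.\<close>

lemma le_tsum_Inf:
  assumes "c \<in> carrier E" "A \<subseteq> carrier E" "z \<in> carrier E"
    and le: "\<And>a. a \<in> A \<Longrightarrow> z \<preceq> c \<oplus> a"
  shows "z \<preceq> c \<oplus> \<^bold>\<Sqinter>A"
proof (cases "c \<preceq> z")
  case True
  then obtain w where w: "w \<in> carrier E" "padd E c w = Some z" by (rule leE)
  have "w \<preceq> a" if "a \<in> A" for a
    using le[OF that] le_tsum_iff[OF assms(1) w] that assms(2) by blast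
  then have "w \<preceq> \<^bold>\<Sqinter>A" using Inf_greatest assms(2) w by blast
  then show ?thesis using le_tsum_iff[OF assms(1) w] assms(2) by simp
next
  case False
  then have "z \<preceq> c" using linear assms by blast
  then show ?thesis using le_transitive[OF _ le_tsum_left] assms by simp
qed

text \<open>Unlike for meets, \<open>A\<close> has to be non-empty: the empty join gives \<open>c \<oplus> 0 = c\<close>, which need not
  be below \<open>z\<close>. The argument uses an element of \<open>A\<close> to place \<open>c\<close> below \<open>z\<close>.\<close>

lemma tsum_Sup_le:
  assumes "c \<in> carrier E" "A \<subseteq> carrier E" "z \<in> carrier E" "A \<noteq> {}"
    and le: "\<And>a. a \<in> A \<Longrightarrow> c \<oplus> a \<preceq> z"
  shows "c \<oplus> \<^bold>\<Squnion>A \<preceq> z"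
proof (cases "z = eone E")
  case True
  then show ?thesis using le_one assms by simp
next
  case False
  obtain a where "a \<in> A" using assms by blast
  then have "c \<preceq> z" using le le_transitive[OF le_tsum_left] assms by blast
  then obtain w where w: "w \<in> carrier E" "padd E c w = Some z" by (rule leE)
  have "a \<preceq> w" if "a \<in> A" for a
    using le[OF that] tsum_le_iff[OF assms(1) w _ False] that assms(2) by blast
  then have "\<^bold>\<Squnion>A \<preceq> w" using Sup_least assms(2) w by blast
  then show ?thesis using tsum_le_iff[OF assms(1) w _ False] assms(2) by simp
qed

section \<open>Meets and joins under q and d\<close>

lemma qmap_in_carrier [simp]: "x \<in> carrier E \<Longrightarrow> qmap E x \<in> carrier E"
  and dmap_in_carrier [simp]: "x \<in> carrier E \<Longrightarrow> dmap E x \<in> carrier E"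
  using qmap_closed dmap_closed by auto

text \<open>The axioms leave no freedom on a chain. If \<open>x\<close> is below its complement then \<open>Q4\<close>, applied to
  the complement, gives \<open>q(x) = x + x\<close>. Otherwise \<open>Q5\<close> bounds \<open>d(x')\<close> by the product
  \<open>x' \<cdot> x = 0\<close>, so \<open>q(x) = 1\<close>.\<close>

lemma qmap_eq_tsum:
  assumes x: "x \<in> carrier E"
  shows "qmap E x = x \<oplus> x"
proof (cases "x \<preceq> \<^bold>-x")
  case True
  then have "pmult E (\<^bold>-x) (\<^bold>-x) = Some (\<^bold>-(qmap E x))"
    using Q4[of "\<^bold>-x"] Q1[OF x] x by simp
  then show ?thesis using x by (simp add: pmult_eq_Some_iff tsum_def)
next
  case False
  then have le: "\<^bold>-x \<preceq> x" using linear[of x "\<^bold>-x"] x by simp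
  obtain w where w: "pmult E (\<^bold>-x) x = Some w" "dmap E (\<^bold>-x) \<preceq> w"
    using Q5[of "\<^bold>-x" x "\<^bold>-x"] le le_reflexive[of "\<^bold>-x"] x by auto
  have w_closed: "w \<in> carrier E" and "\<^bold>-w = eone E"
    using w(1) padd_ecompl[OF x] x by (auto simp: pmult_eq_Some_iff)
  then have "w = ezero E" using ecompl_ecompl ecompl_one by metis
  then have "\<^bold>-(qmap E x) = ezero E"
    using w(2) Q1[OF x] le_antisymmetric zero_le x by simp
  then have "qmap E x = eone E" using ecompl_ecompl[of "qmap E x"] ecompl_zero x by simp
  moreover have "padd E x x = None" using False padd_defined_iff[OF x x] by simp
  ultimately show ?thesis by (simp add: tsum_def)
qed

lemma qmap_mono: "\<lbrakk>x \<preceq> y; x \<in> carrier E; y \<in> carrier E\<rbrakk> \<Longrightarrow> qmap E x \<preceq> qmap E y"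
  by (simp add: qmap_eq_tsum tsum_mono)

text \<open>A lower bound of the sums \<open>a \<oplus> a\<close> also bounds the mixed sums \<open>a \<oplus> b\<close>, because on a
  chain one of \<open>a\<close>, \<open>b\<close> is the smaller; the meet is then taken in each argument separately.\<close>

lemma qmap_Inf:
  assumes A: "A \<subseteq> carrier E"
  shows "qmap E (\<^bold>\<Sqinter>A) = \<^bold>\<Sqinter>(qmap E ` A)"
proof (rule Inf_eqI)
  show "qmap E (\<^bold>\<Sqinter>A) \<preceq> x" if "x \<in> qmap E ` A" for x
    using that A by (auto intro!: qmap_mono Inf_lower)
  show "z \<preceq> qmap E (\<^bold>\<Sqinter>A)" if z: "z \<in> carrier E" "\<And>x. x \<in> qmap E ` A \<Longrightarrow> z \<preceq> x" for z
  proof -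
    have sq: "z \<preceq> a \<oplus> a" if "a \<in> A" for a
      using z(2)[of "qmap E a"] that A by (auto simp: qmap_eq_tsum)
    have mixed: "z \<preceq> a \<oplus> b" if ab: "a \<in> A" "b \<in> A" for a b
    proof (cases "a \<preceq> b")
      case True
      then have "a \<oplus> a \<preceq> a \<oplus> b" using ab A by (auto intro!: tsum_mono_right)
      then show ?thesis by (rule le_transitive[OF sq[OF ab(1)]]) (rule z(1))
    next
      case False
      then have "b \<preceq> a" using linear ab A by blast
      then have "b \<oplus> b \<preceq> a \<oplus> b" using ab A by (auto intro!: tsum_mono le_reflexive)
      then show ?thesis by (rule le_transitive[OF sq[OF ab(2)]]) (rule z(1))
    qed
    have "z \<preceq> \<^bold>\<Sqinter>A \<oplus> b" if b: "b \<in> A" for b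
      using le_tsum_Inf[of b A z] mixed b A z(1) tsum_commute[of b "\<^bold>\<Sqinter>A"] by auto
    then have "z \<preceq> \<^bold>\<Sqinter>A \<oplus> \<^bold>\<Sqinter>A" using le_tsum_Inf[of "\<^bold>\<Sqinter>A" A z] A z(1) by simp
    then show ?thesis using A by (simp add: qmap_eq_tsum)
  qed
qed (use A in auto)

text \<open>The argument is dual to the one for meets, except that the empty join needs \<open>q(0) = 0\<close>.\<close>

lemma qmap_Sup:
  assumes A: "A \<subseteq> carrier E"
  shows "qmap E (\<^bold>\<Squnion>A) = \<^bold>\<Squnion>(qmap E ` A)"
proof (cases "A = {}")
  case True
  have "ezero E = \<^bold>\<Squnion>{}" by (rule Sup_eqI) (auto simp: ezero_closed zero_le)
  then show ?thesis using True Q2 by simp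
next
  case False
  show ?thesis
  proof (rule Sup_eqI)
    show "x \<preceq> qmap E (\<^bold>\<Squnion>A)" if "x \<in> qmap E ` A" for x
      using that A by (auto intro!: qmap_mono Sup_upper)
    show "qmap E (\<^bold>\<Squnion>A) \<preceq> z" if z: "z \<in> carrier E" "\<And>x. x \<in> qmap E ` A \<Longrightarrow> x \<preceq> z" for z
    proof -
      have sq: "a \<oplus> a \<preceq> z" if "a \<in> A" for a
        using z(2)[of "qmap E a"] that A by (auto simp: qmap_eq_tsum)
      have mixed: "a \<oplus> b \<preceq> z" if ab: "a \<in> A" "b \<in> A" for a b
      proof (cases "a \<preceq> b")
        case True
        then have "a \<oplus> b \<preceq> b \<oplus> b" using ab A by (auto intro!: tsum_mono le_reflexive)
        then show ?thesis by (rule le_transitive[OF _ sq[OF ab(2)]]) (use ab A in \<open>auto intro!: tsum_closed\<close>)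
      next
        case False
        then have "b \<preceq> a" using linear ab A by blast
        then have "a \<oplus> b \<preceq> a \<oplus> a" using ab A by (auto intro!: tsum_mono_right)
        then show ?thesis by (rule le_transitive[OF _ sq[OF ab(1)]]) (use ab A in \<open>auto intro!: tsum_closed\<close>)
      qed
      have "\<^bold>\<Squnion>A \<oplus> b \<preceq> z" if b: "b \<in> A" for b
        using tsum_Sup_le[of b A z] mixed b A z(1) False tsum_commute[of b "\<^bold>\<Squnion>A"] by auto
      then have "\<^bold>\<Squnion>A \<oplus> \<^bold>\<Squnion>A \<preceq> z" using tsum_Sup_le[of "\<^bold>\<Squnion>A" A z] A z(1) False by simp
      then show ?thesis using A by (simp add: qmap_eq_tsum)
    qed
  qed (use A in auto)
qed

lemma dmap_eq: "x \<in> carrier E \<Longrightarrow> dmap E x = \<^bold>-(qmap E (\<^bold>-x))"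
  using Q1[of "\<^bold>-x"] by simp

lemma dmap_image:
  assumes "A \<subseteq> carrier E"
  shows "dmap E ` A = ecompl E ` qmap E ` ecompl E ` A"
  unfolding image_image by (rule image_cong) (use assms dmap_eq in auto)

lemma dmap_Inf:
  assumes A: "A \<subseteq> carrier E"
  shows "dmap E (\<^bold>\<Sqinter>A) = \<^bold>\<Sqinter>(dmap E ` A)"
proof -
  have B: "ecompl E ` A \<subseteq> carrier E" "qmap E ` ecompl E ` A \<subseteq> carrier E" using A by auto
  show ?thesis
    using dmap_eq[OF Inf_closed[OF A]] ecompl_Inf[OF A] qmap_Sup[OF B(1)] ecompl_Sup[OF B(2)]
      dmap_image[OF A] by simp
qed

lemma dmap_Sup:
  assumes A: "A \<subseteq> carrier E"
  shows "dmap E (\<^bold>\<Squnion>A) = \<^bold>\<Squnion>(dmap E ` A)"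
proof -
  have B: "ecompl E ` A \<subseteq> carrier E" "qmap E ` ecompl E ` A \<subseteq> carrier E" using A by auto
  show ?thesis
    using dmap_eq[OF Sup_closed[OF A]] ecompl_Sup[OF A] qmap_Inf[OF B(1)] ecompl_Inf[OF B(2)]
      dmap_image[OF A] by simp
qed

end

section \<open>Direct powers\<close>

lemma carrier_power [simp]: "carrier (direct_power E T) = T \<rightarrow>\<^sub>E carrier E"
  and ezero_power: "ezero (direct_power E T) = (\<lambda>t\<in>T. ezero E)"
  and eone_power: "eone (direct_power E T) = (\<lambda>t\<in>T. eone E)"
  and qmap_power: "qmap (direct_power E T) f = (\<lambda>t\<in>T. qmap E (f t))"
  and dmap_power: "dmap (direct_power E T) f = (\<lambda>t\<in>T. dmap E (f t))"
  by (simp_all add: direct_power_def)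

lemma padd_power_iff:
  "padd (direct_power E T) f g = Some h \<longleftrightarrow>
    h \<in> extensional T \<and> (\<forall>t\<in>T. padd E (f t) (g t) = Some (h t))"
  by (force simp: direct_power_def intro!: extensionalityI[of _ T])

context q_effect_algebra
begin

text \<open>A non-empty index set is what separates \<open>0\<close> from \<open>1\<close> in the power.\<close>

lemma effect_algebra_power:
  assumes "T \<noteq> {}"
  shows "effect_algebra (direct_power E T)"
proof
  obtain t where t: "t \<in> T" using assms by blast
  show "ezero (direct_power E T) \<noteq> eone (direct_power E T)"
  proof
    assume "ezero (direct_power E T) = eone (direct_power E T)"
    then have "(\<lambda>t\<in>T. ezero E) t = (\<lambda>t\<in>T. eone E) t" by (simp only: ezero_power eone_power)
    with t zero_neq_one show False by simp
  qed
  show "ezero (direct_power E T) \<in> carrier (direct_power E T)"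
    "eone (direct_power E T) \<in> carrier (direct_power E T)"
    by (simp_all add: ezero_power eone_power ezero_closed eone_closed)
  fix x assume x: "x \<in> carrier (direct_power E T)"
  show "\<exists>!y. y \<in> carrier (direct_power E T) \<and>
      padd (direct_power E T) x y = Some (eone (direct_power E T))"
  proof (rule ex1I)
    show "(\<lambda>t\<in>T. \<^bold>-(x t)) \<in> carrier (direct_power E T) \<and>
      padd (direct_power E T) x (\<lambda>t\<in>T. \<^bold>-(x t)) = Some (eone (direct_power E T))"
      using x by (simp add: padd_power_iff eone_power PiE_iff padd_ecompl)
    show "y = (\<lambda>t\<in>T. \<^bold>-(x t))" if y: "y \<in> carrier (direct_power E T) \<and>
      padd (direct_power E T) x y = Some (eone (direct_power E T))" for y
    proof (rule extensionalityI)
      show "y s = (\<lambda>t\<in>T. \<^bold>-(x t)) s" if "s \<in> T" for s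
        using that x y ecompl_unique[of "x s" "y s"]
        by (simp add: padd_power_iff eone_power PiE_iff)
    qed (use y in \<open>simp_all add: PiE_iff\<close>)
  qed
  show "x = ezero (direct_power E T)"
    if one: "padd (direct_power E T) x (eone (direct_power E T)) \<noteq> None"
  proof (rule extensionalityI)
    obtain h where h: "padd (direct_power E T) x (eone (direct_power E T)) = Some h"
      using one by blast
    show "x s = ezero (direct_power E T) s" if "s \<in> T" for s
      using that x h E4[of "x s"] by (simp add: padd_power_iff eone_power ezero_power PiE_iff)
  qed (use x in \<open>simp_all add: PiE_iff ezero_power\<close>)
  fix y assume y: "y \<in> carrier (direct_power E T)"
  show "z \<in> carrier (direct_power E T)" if "padd (direct_power E T) x y = Some z" for z
    using that x y by (auto simp: padd_power_iff PiE_iff intro: padd_closed)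
  show "padd (direct_power E T) y x = Some z" if "padd (direct_power E T) x y = Some z" for z
    using that x y by (auto simp: padd_power_iff PiE_iff intro: E1)
  fix z u v
  assume z: "z \<in> carrier (direct_power E T)"
    and u: "padd (direct_power E T) y z = Some u" and v: "padd (direct_power E T) x u = Some v"
  have "\<forall>t\<in>T. \<exists>w. padd E (x t) (y t) = Some w \<and> padd E w (z t) = Some (v t)"
    using x y z u v by (auto simp: padd_power_iff PiE_iff intro: E2)
  from bchoice[OF this] obtain w where
    "\<forall>t\<in>T. padd E (x t) (y t) = Some (w t) \<and> padd E (w t) (z t) = Some (v t)" ..
  then show "\<exists>w. padd (direct_power E T) x y = Some w \<and> padd (direct_power E T) w z = Some v"
    using v by (intro exI[of _ "restrict w T"]) (simp add: padd_power_iff)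
qed

lemma ecompl_power:
  assumes "T \<noteq> {}" "f \<in> carrier (direct_power E T)"
  shows "ecompl (direct_power E T) f = (\<lambda>t\<in>T. \<^bold>-(f t))"
proof -
  interpret pow: effect_algebra "direct_power E T"
    using assms(1) by (rule effect_algebra_power)
  show ?thesis
    by (rule pow.ecompl_unique[symmetric])
      (use assms(2) in \<open>simp_all add: padd_power_iff eone_power PiE_iff padd_ecompl\<close>)
qed

lemma le_power_iff:
  assumes "f \<in> carrier (direct_power E T)" "g \<in> carrier (direct_power E T)"
  shows "f \<sqsubseteq>\<^bsub>eorder (direct_power E T)\<^esub> g \<longleftrightarrow> (\<forall>t\<in>T. f t \<preceq> g t)"
proof
  assume "f \<sqsubseteq>\<^bsub>eorder (direct_power E T)\<^esub> g"
  then obtain h where "h \<in> carrier (direct_power E T)" "padd (direct_power E T) f h = Some g"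
    by (auto simp: eorder_def)
  then show "\<forall>t\<in>T. f t \<preceq> g t"
    by (auto simp: padd_power_iff PiE_iff intro: leI)
next
  assume "\<forall>t\<in>T. f t \<preceq> g t"
  then have "\<forall>t\<in>T. \<exists>z. z \<in> carrier E \<and> padd E (f t) z = Some (g t)" by (blast elim: leE)
  then obtain h where "\<forall>t\<in>T. h t \<in> carrier E \<and> padd E (f t) (h t) = Some (g t)"
    by (auto dest: bchoice)
  then have "restrict h T \<in> carrier (direct_power E T)"
      "padd (direct_power E T) f (restrict h T) = Some g"
    using assms by (auto simp: padd_power_iff PiE_iff)
  then show "f \<sqsubseteq>\<^bsub>eorder (direct_power E T)\<^esub> g"
    unfolding eorder_def by (simp only: gorder.simps) (rule bexI)
qed

lemma pmult_power_iff:
  assumes "T \<noteq> {}" "f \<in> carrier (direct_power E T)" "g \<in> carrier (direct_power E T)"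
  shows "pmult (direct_power E T) f g = Some h \<longleftrightarrow>
    h \<in> carrier (direct_power E T) \<and> (\<forall>t\<in>T. pmult E (f t) (g t) = Some (h t))"
proof -
  interpret pow: effect_algebra "direct_power E T"
    using assms(1) by (rule effect_algebra_power)
  have "pmult (direct_power E T) f g = Some h \<longleftrightarrow> h \<in> carrier (direct_power E T) \<and>
      (\<forall>t\<in>T. padd E (\<^bold>-(f t)) (\<^bold>-(g t)) = Some (\<^bold>-(h t)))"
    unfolding pow.pmult_eq_Some_iff[OF assms(2,3)]
    using ecompl_power[OF assms(1)] assms(2,3)
    by (auto simp: padd_power_iff simp del: carrier_power)
  also have "\<dots> \<longleftrightarrow> h \<in> carrier (direct_power E T) \<and> (\<forall>t\<in>T. pmult E (f t) (g t) = Some (h t))"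
    using assms by (auto simp: pmult_eq_Some_iff PiE_iff)
  finally show ?thesis .
qed

lemma q_effect_algebra_power:
  assumes T: "T \<noteq> {}"
  shows "q_effect_algebra (direct_power E T)"
proof -
  interpret pow: effect_algebra "direct_power E T"
    using T by (rule effect_algebra_power)
  show ?thesis
  proof
    show q: "qmap (direct_power E T) \<in> carrier (direct_power E T) \<rightarrow> carrier (direct_power E T)"
      and d: "dmap (direct_power E T) \<in> carrier (direct_power E T) \<rightarrow> carrier (direct_power E T)"
      using qmap_closed dmap_closed by (auto simp: qmap_power dmap_power PiE_iff)
    show "dmap (direct_power E T) (ezero (direct_power E T)) = ezero (direct_power E T)"
      "qmap (direct_power E T) (ezero (direct_power E T)) = ezero (direct_power E T)"
      by (auto simp: qmap_power dmap_power ezero_power Q2 fun_eq_iff)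
    fix x assume x: "x \<in> carrier (direct_power E T)"
    have qx: "qmap (direct_power E T) x \<in> carrier (direct_power E T)"
      and dx: "dmap (direct_power E T) x \<in> carrier (direct_power E T)"
      using q d x by blast+
    show "dmap (direct_power E T) (ecompl (direct_power E T) x)
        = ecompl (direct_power E T) (qmap (direct_power E T) x)"
      unfolding ecompl_power[OF T x] ecompl_power[OF T qx]
      using x Q1 by (auto simp: dmap_power qmap_power PiE_iff fun_eq_iff)
    show "pmult (direct_power E T) x x = Some (dmap (direct_power E T) x)"
      if "ecompl (direct_power E T) x \<sqsubseteq>\<^bsub>eorder (direct_power E T)\<^esub> x"
    proof -
      have "\<forall>t\<in>T. \<^bold>-(x t) \<preceq> x t"
        using that le_power_iff[OF pow.ecompl_closed[OF x] x] by (simp add: ecompl_power[OF T x])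
      then have "\<forall>t\<in>T. pmult E (x t) (x t) = Some (dmap E (x t))"
        using x Q4 by (auto simp: PiE_iff)
      then show ?thesis using pmult_power_iff[OF T x x] dx by (simp add: dmap_power)
    qed
    fix y assume y: "y \<in> carrier (direct_power E T)"
    show "dmap (direct_power E T) x \<sqsubseteq>\<^bsub>eorder (direct_power E T)\<^esub> dmap (direct_power E T) y"
      if "x \<sqsubseteq>\<^bsub>eorder (direct_power E T)\<^esub> y"
    proof -
      have "dmap (direct_power E T) y \<in> carrier (direct_power E T)" using d y by blast
      moreover have "\<forall>t\<in>T. dmap E (x t) \<preceq> dmap E (y t)"
        using that le_power_iff[OF x y] x y Q3 by (auto simp: PiE_iff)
      ultimately show ?thesis using le_power_iff[OF dx] by (simp add: dmap_power)
    qed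
    fix z assume z: "z \<in> carrier (direct_power E T)"
      and le: "z \<sqsubseteq>\<^bsub>eorder (direct_power E T)\<^esub> x" "z \<sqsubseteq>\<^bsub>eorder (direct_power E T)\<^esub> y"
        "ecompl (direct_power E T) y \<sqsubseteq>\<^bsub>eorder (direct_power E T)\<^esub> x"
    have le': "z t \<preceq> x t" "z t \<preceq> y t" "\<^bold>-(y t) \<preceq> x t" if "t \<in> T" for t
      using le that le_power_iff[OF z x] le_power_iff[OF z y]
        le_power_iff[OF pow.ecompl_closed[OF y] x] by (simp_all add: ecompl_power[OF T y])
    have "\<exists>w. pmult E (x t) (y t) = Some w \<and> dmap E (z t) \<preceq> w" if "t \<in> T" for t
      using Q5[OF _ _ _ le'[OF that]] that x y z by (simp add: PiE_iff)
    then obtain w where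
      w: "\<forall>t\<in>T. pmult E (x t) (y t) = Some (w t) \<and> dmap E (z t) \<preceq> w t"
      by (metis (no_types))
    have wc: "restrict w T \<in> carrier (direct_power E T)"
      using w x y by (auto simp: pmult_eq_Some_iff PiE_iff)
    have "dmap (direct_power E T) z \<in> carrier (direct_power E T)" using d z by blast
    then have "dmap (direct_power E T) z \<sqsubseteq>\<^bsub>eorder (direct_power E T)\<^esub> restrict w T"
      using w wc by (subst le_power_iff) (auto simp: dmap_power)
    moreover have "pmult (direct_power E T) x y = Some (restrict w T)"
      using w wc pmult_power_iff[OF T x y] by simp
    ultimately show "\<exists>w. pmult (direct_power E T) x y = Some w \<and>
        dmap (direct_power E T) z \<sqsubseteq>\<^bsub>eorder (direct_power E T)\<^esub> w"
      by blast
  qed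
qed

end

section \<open>The adjunction\<close>

definition P_star ::
  "('a, 'b) q_effect_alg_scheme \<Rightarrow> 's set \<Rightarrow> 't set \<Rightarrow> ('s \<times> 't) set \<Rightarrow> ('s \<Rightarrow> 'a) \<Rightarrow> 't \<Rightarrow> 'a" where
  "P_star M S T R r = (\<lambda>t\<in>T. \<Squnion>\<^bsub>eorder M\<^esub> {r s |s. s \<in> S \<and> (s, t) \<in> R})"

context complete_q_chain
begin

lemma P_star_closed:
  "r \<in> carrier (direct_power E S) \<Longrightarrow> P_star E S T R r \<in> carrier (direct_power E T)"
  by (auto simp: P_star_def PiE_iff intro!: Sup_closed)

lemma G_star_closed:
  "p \<in> carrier (direct_power E T) \<Longrightarrow> G_star E S T R p \<in> carrier (direct_power E S)"
  by (auto simp: G_star_def PiE_iff intro!: Inf_closed)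

text \<open>Both inequalities say that \<open>r(s) \<preceq> p(t)\<close> whenever \<open>s\<close> is related to \<open>t\<close>.\<close>

lemma P_star_adjoint:
  assumes r: "r \<in> carrier (direct_power E S)" and p: "p \<in> carrier (direct_power E T)"
  shows "P_star E S T R r \<sqsubseteq>\<^bsub>eorder (direct_power E T)\<^esub> p \<longleftrightarrow>
    r \<sqsubseteq>\<^bsub>eorder (direct_power E S)\<^esub> G_star E S T R p"
proof -
  have rc: "r s \<in> carrier E" if "s \<in> S" for s using r that by auto
  have pc: "p t \<in> carrier E" if "t \<in> T" for t using p that by auto
  have Sup_le: "\<^bold>\<Squnion>{r s |s. s \<in> S \<and> (s, t) \<in> R} \<preceq> p t \<longleftrightarrow> (\<forall>s\<in>S. (s, t) \<in> R \<longrightarrow> r s \<preceq> p t)"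
    if "t \<in> T" for t
  proof -
    have sub: "{r s |s. s \<in> S \<and> (s, t) \<in> R} \<subseteq> carrier E" using rc by auto
    show ?thesis
      using Sup_least[OF sub pc[OF that]] le_transitive[OF Sup_upper[OF sub]] rc by blast
  qed
  have le_Inf: "r s \<preceq> \<^bold>\<Sqinter>{p t |t. t \<in> T \<and> (s, t) \<in> R} \<longleftrightarrow> (\<forall>t\<in>T. (s, t) \<in> R \<longrightarrow> r s \<preceq> p t)"
    if "s \<in> S" for s
  proof -
    have sub: "{p t |t. t \<in> T \<and> (s, t) \<in> R} \<subseteq> carrier E" using pc by auto
    show ?thesis
      using Inf_greatest[OF sub rc[OF that]] le_transitive[OF _ Inf_lower[OF sub]] rc[OF that] by blast
  qed
  show ?thesis
    unfolding le_power_iff[OF P_star_closed[OF r] p] le_power_iff[OF r G_star_closed[OF p]]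
    by (auto simp: P_star_def G_star_def Sup_le le_Inf)
qed

lemma galois_connection_P_star:
  assumes "S \<noteq> {}" "T \<noteq> {}"
  shows "galois_connection \<lparr>orderA = eorder (direct_power E S), orderB = eorder (direct_power E T),
    lower = P_star E S T R, upper = G_star E S T R\<rparr>"
proof -
  interpret powS: effect_algebra "direct_power E S"
    using assms(1) by (rule effect_algebra_power)
  interpret powT: effect_algebra "direct_power E T"
    using assms(2) by (rule effect_algebra_power)
  show ?thesis
    by (intro galois_connection.intro connection.intro galois_connection_axioms.intro)
      (simp_all add: P_star_closed G_star_closed P_star_adjoint powS.eorder.partial_order_axioms
        powT.eorder.partial_order_axioms del: carrier_power)
qed

text \<open>Only the joins over the sets of \<open>R\<close>-predecessors are taken, but such a set may be empty, so the
  empty join has to be preserved too; dually for \<open>G_star\<close> and \<open>R\<close>-successors.\<close>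

lemma P_star_pointwise:
  assumes r: "r \<in> carrier (direct_power E S)"
    and h: "\<And>A. A \<subseteq> carrier E \<Longrightarrow> h (\<^bold>\<Squnion>A) = \<^bold>\<Squnion>(h ` A)"
  shows "P_star E S T R (\<lambda>s\<in>S. h (r s)) = (\<lambda>t\<in>T. h (P_star E S T R r t))"
  unfolding P_star_def
proof (rule restrict_ext)
  fix t assume t: "t \<in> T"
  have "{(\<lambda>s\<in>S. h (r s)) s |s. s \<in> S \<and> (s, t) \<in> R} = h ` {r s |s. s \<in> S \<and> (s, t) \<in> R}"
    by auto
  moreover have "{r s |s. s \<in> S \<and> (s, t) \<in> R} \<subseteq> carrier E" using r by auto
  ultimately show "\<^bold>\<Squnion>{(\<lambda>s\<in>S. h (r s)) s |s. s \<in> S \<and> (s, t) \<in> R} =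
      h ((\<lambda>t\<in>T. \<^bold>\<Squnion>{r s |s. s \<in> S \<and> (s, t) \<in> R}) t)"
    using t h by simp
qed

lemma G_star_pointwise:
  assumes p: "p \<in> carrier (direct_power E T)"
    and h: "\<And>A. A \<subseteq> carrier E \<Longrightarrow> h (\<^bold>\<Sqinter>A) = \<^bold>\<Sqinter>(h ` A)"
  shows "G_star E S T R (\<lambda>t\<in>T. h (p t)) = (\<lambda>s\<in>S. h (G_star E S T R p s))"
  unfolding G_star_def
proof (rule restrict_ext)
  fix s assume s: "s \<in> S"
  have "{(\<lambda>t\<in>T. h (p t)) t |t. t \<in> T \<and> (s, t) \<in> R} = h ` {p t |t. t \<in> T \<and> (s, t) \<in> R}"
    by auto
  moreover have "{p t |t. t \<in> T \<and> (s, t) \<in> R} \<subseteq> carrier E" using p by auto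
  ultimately show "\<^bold>\<Sqinter>{(\<lambda>t\<in>T. h (p t)) t |t. t \<in> T \<and> (s, t) \<in> R} =
      h ((\<lambda>s\<in>S. \<^bold>\<Sqinter>{p t |t. t \<in> T \<and> (s, t) \<in> R}) s)"
    using s h by simp
qed

lemma galois_q_connection_P_star:
  assumes "S \<noteq> {}" "T \<noteq> {}"
  shows "galois_q_connection (direct_power E S) (direct_power E T) (P_star E S T R) (G_star E S T R)"
proof (intro galois_q_connection.intro galois_q_connection_axioms.intro)
  show "q_effect_algebra (direct_power E S)" using assms(1) by (rule q_effect_algebra_power)
  show "q_effect_algebra (direct_power E T)" using assms(2) by (rule q_effect_algebra_power)
  show "galois_connection \<lparr>orderA = eorder (direct_power E S), orderB = eorder (direct_power E T),
      lower = P_star E S T R, upper = G_star E S T R\<rparr>"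
    using assms by (rule galois_connection_P_star)
  fix r assume "r \<in> carrier (direct_power E S)"
  then show "P_star E S T R (qmap (direct_power E S) r) = qmap (direct_power E T) (P_star E S T R r)"
    "P_star E S T R (dmap (direct_power E S) r) = dmap (direct_power E T) (P_star E S T R r)"
    unfolding qmap_power dmap_power by (simp_all only: P_star_pointwise qmap_Sup dmap_Sup)
next
  fix p assume "p \<in> carrier (direct_power E T)"
  then show "G_star E S T R (qmap (direct_power E T) p) = qmap (direct_power E S) (G_star E S T R p)"
    "G_star E S T R (dmap (direct_power E T) p) = dmap (direct_power E S) (G_star E S T R p)"
    unfolding qmap_power dmap_power by (simp_all only: G_star_pointwise qmap_Inf dmap_Inf)
qed

end

lemma lower_adjoint_unique:
  assumes "galois_connection \<lparr>orderA = A, orderB = B, lower = f, upper = g\<rparr>"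
    and "galois_connection \<lparr>orderA = A, orderB = B, lower = f', upper = g\<rparr>"
    and x: "x \<in> carrier A"
  shows "f x = f' x"
proof -
  interpret f: galois_connection "\<lparr>orderA = A, orderB = B, lower = f, upper = g\<rparr>" by fact
  interpret f': galois_connection "\<lparr>orderA = A, orderB = B, lower = f', upper = g\<rparr>" by fact
  interpret B: partial_order B using f.is_order_B by simp
  have closed: "f x \<in> carrier B" "f' x \<in> carrier B"
    using f.lower_closed f'.lower_closed x by simp_all
  have "f x \<sqsubseteq>\<^bsub>B\<^esub> f' x"
    using f.left[of x "f' x"] f'.inflation[of x] closed x by simp
  moreover have "f' x \<sqsubseteq>\<^bsub>B\<^esub> f x"
    using f'.left[of x "f x"] f.inflation[of x] closed x by simp
  ultimately show ?thesis using closed by (rule B.le_antisym)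
qed

theorem theorem2:
  fixes M :: "('a, 'b) q_effect_alg_scheme"
    and S :: "'s set" and T :: "'t set" and R :: "('s \<times> 't) set"
  assumes "q_effect_algebra M"
    and "total_order (eorder M)"
    and "complete_lattice (eorder M)"
    and "frame S T R"
  shows "(\<exists>P. galois_q_connection (direct_power M S) (direct_power M T) P (G_star M S T R)) \<and>
    (\<forall>P. galois_q_connection (direct_power M S) (direct_power M T) P (G_star M S T R) \<longrightarrow>
      (\<forall>r\<in>carrier (direct_power M S). \<forall>t\<in>T.
        P r t = \<Squnion>\<^bsub>eorder M\<^esub> {r s |s. s \<in> S \<and> (s, t) \<in> R}))"
proof -
  interpret M: q_effect_algebra M by fact
  interpret M: complete_q_chain M
    using assms(3) total_order.total_order_total[OF assms(2)]
    by (intro complete_q_chain.intro complete_q_chain_axioms.intro M.q_effect_algebra_axioms)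
      simp_all
  have "S \<noteq> {}" "T \<noteq> {}" using assms(4) by (simp_all add: frame_def)
  then have adj: "galois_q_connection (direct_power M S) (direct_power M T)
      (P_star M S T R) (G_star M S T R)"
    by (rule M.galois_q_connection_P_star)
  have "P r t = \<Squnion>\<^bsub>eorder M\<^esub> {r s |s. s \<in> S \<and> (s, t) \<in> R}"
    if P: "galois_q_connection (direct_power M S) (direct_power M T) P (G_star M S T R)"
      and r: "r \<in> carrier (direct_power M S)" and t: "t \<in> T" for P r t
  proof -
    have "r \<in> carrier (eorder (direct_power M S))" using r by (simp add: eorder_def)
    then have "P r = P_star M S T R r"
      by (rule lower_adjoint_unique[OF galois_q_connection.axioms(3)[OF P]
            galois_q_connection.axioms(3)[OF adj]])
    then show ?thesis using t by (simp add: P_star_def)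
  qed
  with adj show ?thesis by blast
qed

end
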